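(* Fix a known initial distance $d\ge 1$. Let $\mathcal{A}$ be any search strategy (which may depend on $d$), and let $\varepsilon>0$ be any constant. Then $CR_{\mathcal{A}}(u)\notin O(u^{4-\varepsilon})$ as $u\to\infty$; that is, there do not exist constants $a>0$ and $c_1\ge 1$ such that $CR_{\mathcal{A}}(u)\le a\,u^{4-\varepsilon}$ for all $u\ge c_1$.
   Context: Search model: a robot (searcher) starts at the origin $0$ of the real line at time $0$ and can move in either direction with maximum speed $1$. A target starts at distance $d\ge 1$ from the origin on one of the two sides (unknown to the searcher) and moves away from the origin with constant speed $v\in[0,1)$, unknown to the searcher; here $d$ is known to the searcher. The evasiveness of a target of speed $v$ is $u=\frac{1}{1-v}\in[1,\infty)$, so $v=1-\frac1u$. A strategy is a continuous function $\mathcal{A}:[0,\infty)\to\mathbb{R}$ with $\mathcal{A}(0)=0$ and $|\mathcal{A}(t)-\mathcal{A}(t')|\le|t-t'|$ (the robot's position at time $t$). For $\sigma\in\{0,1\}$ (side $\sigma=0$ positive, $\sigma=1$ negative), $T^\sigma_{\mathcal{A}}(u)=\inf\{t\ge 0:\mathcal{A}(t)=(-1)^\sigma(d+(1-\frac1u)t)\}$ (with $\inf\emptyset=\infty$), $T_{opt}(u)=ud$, $CR^\sigma_{\mathcal{A}}(u)=T^\sigma_{\mathcal{A}}(u)/T_{opt}(u)$, and the competitive ratio is $CR_{\mathcal{A}}(u)=\max(CR^0_{\mathcal{A}}(u),CR^1_{\mathcal{A}}(u))$. *)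

theory Defs
  imports "HOL-Analysis.Analysis"
begin

text \<open>
  A strategy is a function on \<open>[0, \<infinity>)\<close>; values at negative times are unconstrained and never used.
\<close>

definition search_strategy :: "(real \<Rightarrow> real) \<Rightarrow> bool" where
  "search_strategy A \<longleftrightarrow>
     continuous_on {0..} A \<and> A 0 = 0 \<and>
     (\<forall>t\<ge>0. \<forall>t'\<ge>0. \<bar>A t - A t'\<bar> \<le> \<bar>t - t'\<bar>)"

text \<open>
  The side \<open>\<sigma>\<close> is \<open>0\<close> (positive half-line) or \<open>1\<close> (negative half-line).
  A target of evasiveness \<open>u = 1 / (1 - v)\<close> has speed \<open>v = 1 - 1 / u\<close>.
\<close>

definition target_pos :: "real \<Rightarrow> nat \<Rightarrow> real \<Rightarrow> real \<Rightarrow> real" where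
  "target_pos d \<sigma> u t = (-1) ^ \<sigma> * (d + (1 - 1 / u) * t)"

text \<open>
  Times are extended reals, so that the infimum of the empty set is \<open>\<infinity>\<close>.
\<close>

definition search_time :: "real \<Rightarrow> (real \<Rightarrow> real) \<Rightarrow> nat \<Rightarrow> real \<Rightarrow> ereal" where
  "search_time d A \<sigma> u = Inf (ereal ` {t. 0 \<le> t \<and> A t = target_pos d \<sigma> u t})"

definition opt_time :: "real \<Rightarrow> real \<Rightarrow> real" where
  "opt_time d u = u * d"

definition side_competitive_ratio :: "real \<Rightarrow> (real \<Rightarrow> real) \<Rightarrow> nat \<Rightarrow> real \<Rightarrow> ereal" where
  "side_competitive_ratio d A \<sigma> u = search_time d A \<sigma> u / ereal (opt_time d u)"

definition competitive_ratio :: "real \<Rightarrow> (real \<Rightarrow> real) \<Rightarrow> real \<Rightarrow> ereal" where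
  "competitive_ratio d A u =
     max (side_competitive_ratio d A 0 u) (side_competitive_ratio d A 1 u)"

end

theory Submission
  imports Defs
begin

text \<open>
  At time \<open>t\<close> the robot on side \<open>s = \<plusminus>1\<close> catches exactly the target of evasiveness
  \<open>f\<^sub>s t = t / (d + t - s A(t))\<close>. Write \<open>\<pi> t\<close> for the time at which the opposite side attains its
  maximal evasiveness \<open>w\<close> on \<open>[0, t]\<close>. Crossing the line from one moving front to the other
  costs a factor: if a target is caught at time \<open>r\<close> and one of evasiveness \<open>w\<close> on the other side
  at time \<open>t' \<ge> r\<close>, then \<open>t' \<ge> w r\<close>. Hence \<open>w \<le> \<pi> t / \<pi> (\<pi> t)\<close>, while a target of evasiveness
  \<open>2 w\<close> is only caught at a time \<open>\<ge> 2 w t\<close>. If search times are \<open>O(u\<^bsup>q+1\<^esup>)\<close>, this gives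
  \<open>ln t \<le> k + q (ln (\<pi> t) - ln (\<pi> (\<pi> t)))\<close>. For \<open>q < 4\<close> the characteristic polynomial
  \<open>\<lambda>\<^sup>2 - q \<lambda> + q\<close> has no real root, so the ratio \<open>ln t / ln (\<pi> t)\<close> is smaller by a fixed amount
  than the same ratio at \<open>\<pi> t\<close>, and iterating forces it below \<open>1\<close>, contradicting \<open>\<pi> t \<le> t\<close>.
\<close>

text \<open>Here \<open>x\<close> abstracts the logarithm of time and \<open>\<pi>\<close> the step
  back. Induction on \<open>n\<close> bounds \<open>x p / x (\<pi> p)\<close> by
  \<open>q + 1 - n * \<eta>\<close> beyond a threshold depending on \<open>n\<close>; finitely many
  steps suffice.\<close>

lemma backward_recurrence_contradiction:
  fixes x :: "'a \<Rightarrow> real" and \<pi> :: "'a \<Rightarrow> 'a" and D :: "'a set" and k q :: real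
  assumes q: "0 < q" "q < 4"
    and backward: "\<And>X. \<exists>Y. \<forall>p\<in>D. x p \<ge> Y \<longrightarrow>
        \<pi> p \<in> D \<and> X \<le> x (\<pi> p) \<and> x (\<pi> p) \<le> x p \<and> x p \<le> k + q * (x (\<pi> p) - x (\<pi> (\<pi> p)))"
    and unbounded: "\<And>X. \<exists>p\<in>D. x p \<ge> X"
  shows False
proof -
  \<comment> \<open>If \<open>c\<close> bounds the ratio at \<open>\<pi> p\<close>, the recurrence
    bounds it at \<open>p\<close> by \<open>q - q / c\<close>, up to the term from \<open>k\<close>.
    The gain \<open>c + q / c - q\<close> is at least \<open>2 * sqrt q - q\<close>;
    \<open>\<eta>\<close> is half of this, and the other half absorbs \<open>k\<close>.\<close>
  define \<eta> where "\<eta> = (2 * sqrt q - q) / 2"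
  have "sqrt q < 2"
    using q real_sqrt_less_mono[of q 4] by simp
  then have "sqrt q * sqrt q < 2 * sqrt q"
    using q by (intro mult_strict_right_mono) auto
  then have \<eta>: "\<eta> > 0"
    using q by (simp add: \<eta>_def)
  have ge_1: "c \<ge> 1" if Y: "\<forall>p\<in>D. x p \<ge> Y \<longrightarrow> x p \<le> c * x (\<pi> p)" for c Y
  proof -
    obtain Z where Z: "\<forall>p\<in>D. x p \<ge> Z \<longrightarrow> 1 \<le> x (\<pi> p) \<and> x (\<pi> p) \<le> x p"
      using backward[of 1] by blast
    obtain p where p: "p \<in> D" "x p \<ge> max Y Z"
      using unbounded by blast
    then have "1 * x (\<pi> p) \<le> c * x (\<pi> p)" "1 \<le> x (\<pi> p)"
      using Y Z by (auto intro: order_trans)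
    then show ?thesis
      by (simp add: mult_le_cancel_right)
  qed
  have "\<exists>Y. \<forall>p\<in>D. x p \<ge> Y \<longrightarrow> x p \<le> (q + 1 - real n * \<eta>) * x (\<pi> p)" for n
  proof (induction n)
    case 0
    obtain Y0 where Y0: "\<forall>p\<in>D. x p \<ge> Y0 \<longrightarrow> 0 \<le> x (\<pi> p)"
      using backward[of 0] by blast
    obtain Y where Y: "\<forall>p\<in>D. x p \<ge> Y \<longrightarrow> \<pi> p \<in> D \<and> max k Y0 \<le> x (\<pi> p)
        \<and> x p \<le> k + q * (x (\<pi> p) - x (\<pi> (\<pi> p)))"
      using backward[of "max k Y0"] by blast
    have "x p \<le> (q + 1 - real 0 * \<eta>) * x (\<pi> p)" if "p \<in> D" "x p \<ge> Y" for p
    proof -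
      have "0 \<le> q * x (\<pi> (\<pi> p))"
        using that Y Y0 q by auto
      moreover have "x p \<le> k + q * (x (\<pi> p) - x (\<pi> (\<pi> p)))" "k \<le> x (\<pi> p)"
        using that Y by auto
      ultimately show ?thesis
        by (simp add: algebra_simps)
    qed
    then show ?case by blast
  next
    case (Suc n)
    define c where "c = q + 1 - real n * \<eta>"
    obtain Y0 where Y0: "\<forall>p\<in>D. x p \<ge> Y0 \<longrightarrow> x p \<le> c * x (\<pi> p)"
      using Suc.IH unfolding c_def by blast
    have c: "c \<ge> 1"
      using ge_1[OF Y0] .
    have "0 \<le> (c - sqrt q)\<^sup>2"
      by simp
    then have amgm: "q * (c - 1) \<le> c * (c - 2 * \<eta>)"
      using q by (simp add: \<eta>_def power2_diff field_simps power2_eq_square)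
    \<comment> \<open>Above \<open>k / \<eta>\<close>, the constant \<open>k\<close> costs at most
      \<open>\<eta> * x (\<pi> p)\<close>; above \<open>Y0\<close>, the induction hypothesis applies
      at \<open>\<pi> p\<close>.\<close>
    obtain Y where Y: "\<forall>p\<in>D. x p \<ge> Y \<longrightarrow> \<pi> p \<in> D \<and> max (k / \<eta>) (max 0 Y0) \<le> x (\<pi> p)
        \<and> x p \<le> k + q * (x (\<pi> p) - x (\<pi> (\<pi> p)))"
      using backward[of "max (k / \<eta>) (max 0 Y0)"] by blast
    have "x p \<le> (c - \<eta>) * x (\<pi> p)" if "p \<in> D" "x p \<ge> Y" for p
    proof -
      let ?s = "x (\<pi> p)" and ?r = "x (\<pi> (\<pi> p))"
      have s: "?s \<le> c * ?r" "k / \<eta> \<le> ?s" "0 \<le> ?s" and p: "x p \<le> k + q * (?s - ?r)"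
        using that Y Y0 by auto
      have k: "k \<le> \<eta> * ?s"
        using s \<eta> by (simp add: field_simps)
      have "c * (q * (?s - ?r)) = q * (c * ?s - c * ?r)"
        by (simp add: algebra_simps)
      also have "\<dots> \<le> q * (c * ?s - ?s)"
        using s q by (intro mult_left_mono) auto
      also have "\<dots> = q * (c - 1) * ?s"
        by (simp add: algebra_simps)
      also have "\<dots> \<le> c * (c - 2 * \<eta>) * ?s"
        using amgm s by (intro mult_right_mono)
      finally have "c * (q * (?s - ?r)) \<le> c * ((c - 2 * \<eta>) * ?s)"
        by (simp add: mult.assoc)
      then have "q * (?s - ?r) \<le> (c - 2 * \<eta>) * ?s"
        using c by (simp add: mult_le_cancel_left)
      then show ?thesis
        using p k by (simp add: algebra_simps)
    qed
    moreover have "c - \<eta> = q + 1 - real (Suc n) * \<eta>"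
      by (simp add: c_def algebra_simps)
    ultimately show ?case by auto
  qed
  then have "q + 1 - real n * \<eta> \<ge> 1" for n
    using ge_1 by blast
  moreover obtain n where "real n * \<eta> > q"
    using reals_Archimedean3[OF \<eta>] by blast
  ultimately show False
    by (smt (verit))
qed

text \<open>This solves \<open>s * A t = d + (1 - 1 / u) * t\<close> for \<open>u\<close>. A value
  below 1 belongs to no admissible target.\<close>

definition caught_evasiveness :: "real \<Rightarrow> (real \<Rightarrow> real) \<Rightarrow> real \<Rightarrow> real \<Rightarrow> real" where
  "caught_evasiveness d A s t = t / (d + t - s * A t)"

lemma strategy_signed_le:
  assumes "search_strategy A" "s \<in> {1, -1}" "0 \<le> t"
  shows "s * A t \<le> t"
proof -
  have "\<bar>A t - A 0\<bar> \<le> \<bar>t - 0\<bar>" "A 0 = 0"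
    using assms by (auto simp: search_strategy_def)
  then show ?thesis
    using assms by auto
qed

lemma caught_evasiveness_le:
  assumes "d \<ge> 1" "search_strategy A" "s \<in> {1, -1}" "0 \<le> t"
  shows "caught_evasiveness d A s t \<le> t"
proof -
  have "1 \<le> d + t - s * A t"
    using assms strategy_signed_le[OF assms(2-4)] by simp
  then have "t / (d + t - s * A t) \<le> t / 1"
    using assms by (intro divide_left_mono) auto
  then show ?thesis
    by (simp add: caught_evasiveness_def)
qed

text \<open>At time \<open>t\<close> the robot is at distance at least \<open>d\<close> on side
  \<open>s\<close>. Having speed at most 1, it is still so far from the front on side
  \<open>-s\<close> at time \<open>t'\<close> that the denominator there is at least
  \<open>t\<close>.\<close>

lemma caught_evasiveness_opposite:
  assumes "d \<ge> 1" "search_strategy A" "s \<in> {1, -1}" "0 \<le> t" "t \<le> t'"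
    and "caught_evasiveness d A s t \<ge> 1"
  shows "caught_evasiveness d A (-s) t' * t \<le> t'"
proof -
  have pos: "d + t - s * A t > 0" "d + t' - (-s) * A t' > 0"
    using assms strategy_signed_le[of A s t] strategy_signed_le[of A "-s" t'] by auto
  have "s * A t \<ge> d"
    using assms(6) pos by (simp add: caught_evasiveness_def)
  moreover have "\<bar>A t - A t'\<bar> \<le> \<bar>t - t'\<bar>"
    using assms(2,4,5) unfolding search_strategy_def by (meson order_trans)
  ultimately have "t \<le> d + t' - (-s) * A t'"
    using assms by auto
  then have "t' * t \<le> t' * (d + t' - (-s) * A t')"
    using assms by (intro mult_left_mono) auto
  then show ?thesis
    using pos by (simp add: caught_evasiveness_def field_simps)
qed

lemma caught_evasiveness_attains_max:
  assumes "d \<ge> 1" "search_strategy A" "s \<in> {1, -1}" "0 \<le> t"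
  shows "\<exists>r\<in>{0..t}. \<forall>r'\<in>{0..t}. caught_evasiveness d A s r' \<le> caught_evasiveness d A s r"
proof (rule continuous_attains_sup)
  have "continuous_on {0..t} A"
    using assms continuous_on_subset[of "{0..}" A "{0..t}"] by (auto simp: search_strategy_def)
  moreover have "d + r - s * A r \<noteq> 0" if "r \<in> {0..t}" for r
    using that assms strategy_signed_le[of A s r] by auto
  ultimately show "continuous_on {0..t} (caught_evasiveness d A s)"
    unfolding caught_evasiveness_def by (intro continuous_intros) auto
qed (use assms in auto)

text \<open>The exponent is \<open>q + 1\<close> because the optimal time adds one factor
  \<open>u\<close> to a ratio of order \<open>u powr q\<close>.\<close>

lemma search_times_not_polynomial:
  fixes d q K c :: real
  assumes d: "d \<ge> 1" and A: "search_strategy A" and q: "0 < q" "q < 4" and K: "K > 0" and c: "c \<ge> 1"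
    and catch: "\<And>s u. s \<in> {1, -1} \<Longrightarrow> u \<ge> c \<Longrightarrow>
      \<exists>t\<ge>0. t \<le> K * u powr (q + 1) \<and> caught_evasiveness d A s t = u"
  shows False
proof -
  define f where "f = caught_evasiveness d A"
  define best where "best s t =
    (SOME r. r \<in> {0..t} \<and> (\<forall>r'\<in>{0..t}. f s r' \<le> f s r))" for s t
  have best: "0 \<le> best s t" "best s t \<le> t" "\<And>r. 0 \<le> r \<Longrightarrow> r \<le> t \<Longrightarrow> f s r \<le> f s (best s t)"
    if "s \<in> {1, -1}" "0 \<le> t" for s t
  proof -
    have "best s t \<in> {0..t} \<and> (\<forall>r'\<in>{0..t}. f s r' \<le> f s (best s t))"
      unfolding best_def
      by (rule someI_ex) (use caught_evasiveness_attains_max[OF d A that] in \<open>auto simp: f_def\<close>)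
    then show "0 \<le> best s t" "best s t \<le> t" "\<And>r. 0 \<le> r \<Longrightarrow> r \<le> t \<Longrightarrow> f s r \<le> f s (best s t)"
      by auto
  qed
  \<comment> \<open>By time \<open>t\<close> a target of evasiveness \<open>U\<close> has been
    caught, so the record is at least \<open>U\<close>; the time of a record is never below its
    value.\<close>
  have best_large: "U \<le> f s (best s t)" "U \<le> best s t"
    if s: "s \<in> {1, -1}" and U: "U \<ge> c" and t: "K * U powr (q + 1) \<le> t" for s U t
  proof -
    obtain r where r: "0 \<le> r" "r \<le> t" "f s r = U"
      using catch[OF s U] t unfolding f_def by force
    then show "U \<le> f s (best s t)"
      using best(3)[OF s, of t r] by auto
    also have "\<dots> \<le> best s t"
      using caught_evasiveness_le[OF d A s best(1)[OF s]] r unfolding f_def by simp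
    finally show "U \<le> best s t" .
  qed
  \<comment> \<open>The condition \<open>1 \<le> f s t\<close> lets the crossing estimate start from
    every point of \<open>D\<close>.\<close>
  define D where "D = {(s, t). s \<in> {1, -1} \<and> 0 < t \<and> 1 \<le> f s t}"
  define \<pi> where "\<pi> = (\<lambda>(s, t). (-s, best (-s) t))"
  define x where "x = (\<lambda>(s :: real, t :: real). ln t)"
  define k where "k = ln K + q * ln 2"
  show False
  proof (rule backward_recurrence_contradiction[of q D x \<pi> k])
    fix X :: real
    \<comment> \<open>Nested thresholds for two steps back: \<open>t\<close> beyond the bound for
      \<open>U\<close> gives \<open>r \<ge> U\<close>, which is beyond the bound for
      \<open>V\<close>, so the second record and its time \<open>z\<close> are at least
      \<open>V\<close>.\<close>
    define V where "V = max c (exp X)"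
    define U where "U = max V (K * V powr (q + 1))"
    have V: "V \<ge> c" "V \<ge> 1" "V \<ge> exp X" and U: "U \<ge> V" "K * V powr (q + 1) \<le> U"
      using c by (auto simp: V_def U_def)
    have "\<pi> (s, t) \<in> D \<and> X \<le> x (\<pi> (s, t)) \<and> x (\<pi> (s, t)) \<le> x (s, t) \<and>
        x (s, t) \<le> k + q * (x (\<pi> (s, t)) - x (\<pi> (\<pi> (s, t))))"
      if st: "(s, t) \<in> D" "x (s, t) \<ge> ln (K * U powr (q + 1))" for s t
    proof -
      have s: "s \<in> {1, -1}" "-s \<in> {1, -1}" and t: "t > 0" "f s t \<ge> 1"
        using st by (auto simp: D_def)
      have tU: "K * U powr (q + 1) \<le> t"
        using st(2) t K U V by (simp add: x_def)
      define r where "r = best (-s) t"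
      define z where "z = best s r"
      have r: "r \<le> t" "U \<le> f (-s) r" "U \<le> r"
        using best(2)[OF s(2)] best_large[OF s(2) _ tU] t U V unfolding r_def by auto
      have z: "z \<le> r" "V \<le> f s z" "V \<le> z"
        using best(2)[OF s(1), of r] best_large[OF s(1) V(1), of r] r U V unfolding z_def by auto
      have pos: "r > 0" "z > 0"
        using r z U V by auto
      define w where "w = f (-s) r"
      have w: "w \<ge> c" "w > 0" "w * z \<le> r"
        using r U V c caught_evasiveness_opposite[OF d A s(1), of z r] z pos
        unfolding w_def f_def by auto
      \<comment> \<open>Evasiveness \<open>2 * w\<close> beats the record \<open>w\<close> on
        \<open>[0, t]\<close>, so its target is caught only after \<open>t\<close>. The factor 2 is
        the source of \<open>q * ln 2\<close> in \<open>k\<close>.\<close>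
      obtain t' where t': "0 \<le> t'" "t' \<le> K * (2 * w) powr (q + 1)" "f (-s) t' = 2 * w"
        using catch[OF s(2), of "2 * w"] w c unfolding f_def by auto
      have "t' > t"
        using best(3)[OF s(2), of t t'] t t' w unfolding w_def r_def by force
      then have "2 * w * t \<le> t'"
        using caught_evasiveness_opposite[OF d A s(1), of t t'] t t' unfolding f_def by auto
      \<comment> \<open>Splitting off one factor \<open>2 * w\<close> cancels the crossing cost and
        lowers the exponent from \<open>q + 1\<close> to \<open>q\<close>.\<close>
      also have "t' \<le> 2 * w * (K * (2 * w) powr q)"
        using t' w by (simp add: powr_add mult_ac)
      finally have "t \<le> K * (2 * w) powr q"
        using w by (simp add: mult_le_cancel_left)
      then have "ln t \<le> ln (K * (2 * w) powr q)"
        using t w K by simp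
      also have "\<dots> = k + q * ln w"
        using w K by (simp add: k_def ln_mult ln_powr algebra_simps)
      also have "ln w \<le> ln (r / z)"
        using w pos by (simp add: field_simps)
      then have "k + q * ln w \<le> k + q * (ln r - ln z)"
        using q pos by (simp add: ln_div)
      finally have "ln t \<le> k + q * (ln r - ln z)" .
      moreover have "X \<le> ln r"
        using V U r pos by (simp add: ln_ge_iff)
      moreover have "f (-s) r \<ge> 1"
        using r U V by simp
      ultimately show ?thesis
        using r pos s t by (auto simp: \<pi>_def x_def D_def r_def[symmetric] z_def[symmetric])
    qed
    then show "\<exists>Y. \<forall>p\<in>D. x p \<ge> Y \<longrightarrow>
        \<pi> p \<in> D \<and> X \<le> x (\<pi> p) \<and> x (\<pi> p) \<le> x p \<and> x p \<le> k + q * (x (\<pi> p) - x (\<pi> (\<pi> p)))"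
      by fast
  next
    fix X :: real
    obtain t where t: "0 \<le> t" "f 1 t = max c (exp X)"
      using catch[of 1 "max c (exp X)"] unfolding f_def by auto
    then have "max c (exp X) \<le> t"
      using caught_evasiveness_le[OF d A, of 1 t] unfolding f_def by auto
    then have "(1, t) \<in> D" "x (1, t) \<ge> X"
      using t c by (auto simp: D_def x_def ln_ge_iff)
    then show "\<exists>p\<in>D. x p \<ge> X" by blast
  qed (use q in auto)
qed

text \<open>A strict bound on the infimum yields an actual meeting time, whether or not the infimum
  is attained.\<close>

lemma search_time_less_imp_caught:
  assumes "d \<ge> 1" "search_strategy A" "u > 0" "search_time d A \<sigma> u < ereal B"
  shows "\<exists>t\<ge>0. t \<le> B \<and> caught_evasiveness d A ((-1) ^ \<sigma>) t = u"
proof -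
  obtain t where t: "0 \<le> t" "A t = target_pos d \<sigma> u t" "t < B"
    using assms(4) unfolding search_time_def Inf_less_iff by auto
  have sign: "(-1 :: real) ^ \<sigma> * (-1) ^ \<sigma> = 1"
    by (simp flip: power_add)
  have "(-1) ^ \<sigma> * A t = d + (1 - 1 / u) * t"
    using t(2) sign unfolding target_pos_def by (metis mult.assoc mult.left_neutral)
  then have eq: "d + t - (-1) ^ \<sigma> * A t = t / u"
    by (simp add: algebra_simps)
  have "d + t - (-1) ^ \<sigma> * A t > 0"
    using assms t strategy_signed_le[OF assms(2), of "(-1) ^ \<sigma>" t]
    by (cases "even \<sigma>") auto
  then have "t > 0"
    using eq assms(3) by (simp add: zero_less_divide_iff)
  then have "caught_evasiveness d A ((-1) ^ \<sigma>) t = u"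
    using assms by (simp add: caught_evasiveness_def eq)
  then show ?thesis
    using t by auto
qed

theorem theorem1:
  fixes d \<epsilon> :: real and A :: "real \<Rightarrow> real"
  assumes "d \<ge> 1" and "search_strategy A" and "\<epsilon> > 0"
  shows "\<not> (\<exists>a c\<^sub>1 :: real. a > 0 \<and> c\<^sub>1 \<ge> 1 \<and>
            (\<forall>u\<ge>c\<^sub>1. competitive_ratio d A u \<le> ereal (a * u powr (4 - \<epsilon>))))"
proof
  assume "\<exists>a c\<^sub>1 :: real. a > 0 \<and> c\<^sub>1 \<ge> 1 \<and>
            (\<forall>u\<ge>c\<^sub>1. competitive_ratio d A u \<le> ereal (a * u powr (4 - \<epsilon>)))"
  then obtain a c where a: "a > 0" and c: "c \<ge> 1"
    and CR: "\<And>u. u \<ge> c \<Longrightarrow> competitive_ratio d A u \<le> ereal (a * u powr (4 - \<epsilon>))"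
    by blast
  \<comment> \<open>The maximum with 1 keeps \<open>q\<close> positive for large
    \<open>\<epsilon>\<close>; raising the exponent is harmless since
    \<open>u \<ge> 1\<close>.\<close>
  define q where "q = max (4 - \<epsilon>) 1"
  have time: "search_time d A \<sigma> u < ereal (2 * a * d * u powr (q + 1))"
    if "\<sigma> \<in> {0, 1}" and u: "u \<ge> c" for \<sigma> u
  proof -
    have ud: "u * d > 0"
      using u c assms by (intro mult_pos_pos) auto
    have "side_competitive_ratio d A \<sigma> u \<le> competitive_ratio d A u"
      using that by (auto simp: competitive_ratio_def)
    also have "\<dots> \<le> ereal (a * u powr (4 - \<epsilon>))"
      using CR[OF u] .
    also have "\<dots> \<le> ereal (a * u powr q)"
      using a u c by (auto simp: q_def intro!: mult_left_mono powr_mono)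
    \<comment> \<open>Doubling the constant makes the bound strict, as needed to extract a meeting
      time.\<close>
    also have "\<dots> < ereal (2 * a * u powr q)"
      using a u c by simp
    finally have "search_time d A \<sigma> u / ereal (u * d) < ereal (2 * a * u powr q)"
      by (simp add: side_competitive_ratio_def opt_time_def)
    then have "search_time d A \<sigma> u < ereal (2 * a * u powr q) * ereal (u * d)"
      using ud by (simp add: ereal_divide_less_iff mult.commute)
    then show ?thesis
      using u c by (simp add: powr_add mult_ac)
  qed
  have "\<exists>t\<ge>0. t \<le> 2 * a * d * u powr (q + 1) \<and> caught_evasiveness d A s t = u"
    if "s \<in> {1, -1}" "u \<ge> c" for s u
    using that c search_time_less_imp_caught[OF assms(1,2) _ time, of u 0]
      search_time_less_imp_caught[OF assms(1,2) _ time, of u 1] by auto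
  moreover have "0 < q" "q < 4" "0 < 2 * a * d"
    using assms a by (auto simp: q_def less_max_iff_disj)
  ultimately show False
    using search_times_not_polynomial[OF assms(1,2), of q "2 * a * d" c] c by blast
qed

end
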